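(* Consider an invertible transformation (or a flow) preserving and ergodic with respect to a finite measure, and let $U$ be a $\log$-integrable cocycle over it with values in the group $\mathrm U(p,q)$ of pseudo-unitary matrices. Then the Lyapunov spectrum of $U$ is symmetric with respect to sign change and has at least $|p-q|$ zero exponents. In other words, the Lyapunov spectrum (the list of $p+q$ Lyapunov exponents, with multiplicity, in non-increasing order) has the form $$\lambda_1\ge\dots\ge\lambda_r\ge 0=\dots=0\ge-\lambda_r\ge\dots\ge-\lambda_1,\qquad r=\min(p,q),$$ with $|p-q|$ zeros written in the middle. In particular, if $r=0$, all exponents are zero.
   Context: $\mathrm U(p,q)$ is the group of complex $(p+q)\times(p+q)$ matrices preserving a Hermitian form of signature $(p,q)$. A cocycle over a flow (or transformation) $T_t$ is a measurable family $U_t(x)$ with $U_{t+s}(x)=U_t(T_sx)U_s(x)$; $\log$-integrability is the usual hypothesis of the Oseledets multiplicative ergodic theorem (integrability of $\log^+\|U_{\pm1}\|$, respectively of $\sup_{|t|\le1}\log^+\|U_t\|$ for a flow). Lyapunov exponents are those given by the Oseledets theorem for complex cocycles, counted with complex multiplicity. *)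

theory Defs
  imports "HOL-Analysis.Analysis"
begin

text \<open>
  Throughout, \<open>'t\<close> is the time group: \<open>int\<close> for the iterates \<open>T n\<close> (\<open>n\<close> an integer) of an
  invertible transformation \<open>T 1\<close>, and \<open>real\<close> for a flow. On \<open>int\<close> the Borel sets are all
  subsets, so the joint measurability conditions below just mean measurability at each time.
\<close>

definition measure_preserving_action ::
    "'a measure \<Rightarrow> ('t::{ab_group_add,topological_space} \<Rightarrow> 'a \<Rightarrow> 'a) \<Rightarrow> bool" where
  "measure_preserving_action M T \<longleftrightarrow>
     (\<lambda>(t, x). T t x) \<in> measurable (borel \<Otimes>\<^sub>M M) M \<and>
     (\<forall>x\<in>space M. T 0 x = x) \<and>
     (\<forall>s t. \<forall>x\<in>space M. T (t + s) x = T t (T s x)) \<and>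
     (\<forall>t. distr M M (T t) = M)"

definition ergodic_action ::
    "'a measure \<Rightarrow> ('t::{ab_group_add,topological_space} \<Rightarrow> 'a \<Rightarrow> 'a) \<Rightarrow> bool" where
  "ergodic_action M T \<longleftrightarrow>
     measure_preserving_action M T \<and>
     (\<forall>A\<in>sets M. (\<forall>t. T t -` A \<inter> space M = A) \<longrightarrow>
        emeasure M A = 0 \<or> emeasure M (space M - A) = 0)"

definition matrix_cocycle ::
    "'a measure \<Rightarrow> ('t::{ab_group_add,topological_space} \<Rightarrow> 'a \<Rightarrow> 'a) \<Rightarrow>
     ('t \<Rightarrow> 'a \<Rightarrow> complex^'n^'n) \<Rightarrow> bool" where
  "matrix_cocycle M T U \<longleftrightarrow>
     (\<lambda>(t, x). U t x) \<in> borel_measurable (borel \<Otimes>\<^sub>M M) \<and>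
     (\<forall>s t. \<forall>x\<in>space M. U (t + s) x = U t (T s x) ** U s x)"

text \<open>
  The matrix norm is the Euclidean norm of the entries; as all norms are equivalent, its choice
  does not affect log-integrability with respect to a finite measure.
\<close>

definition log_plus :: "real \<Rightarrow> real" where
  "log_plus a = (if a \<le> 1 then 0 else ln a)"

definition log_integrable_discrete :: "'a measure \<Rightarrow> (int \<Rightarrow> 'a \<Rightarrow> complex^'n^'n) \<Rightarrow> bool" where
  "log_integrable_discrete M U \<longleftrightarrow>
     integrable M (\<lambda>x. log_plus (norm (U 1 x))) \<and>
     integrable M (\<lambda>x. log_plus (norm (U (- 1) x)))"

text \<open>
  The supremum is taken in \<open>ennreal\<close>, where it exists also when it is infinite. As a supremum over
  an uncountable set it is in general only measurable with respect to the completed measure.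
\<close>

definition log_integrable_flow :: "'a measure \<Rightarrow> (real \<Rightarrow> 'a \<Rightarrow> complex^'n^'n) \<Rightarrow> bool" where
  "log_integrable_flow M U \<longleftrightarrow>
     (\<lambda>x. SUP t\<in>{-1..1}. ennreal (log_plus (norm (U t x)))) \<in> borel_measurable (completion M) \<and>
     (\<integral>\<^sup>+x. (SUP t\<in>{-1..1}. ennreal (log_plus (norm (U t x)))) \<partial>completion M) < \<infinity>"

definition sesquilinear_form :: "complex^'n^'n \<Rightarrow> complex^'n \<Rightarrow> complex^'n \<Rightarrow> complex" where
  "sesquilinear_form H v w = (\<Sum>i\<in>UNIV. \<Sum>j\<in>UNIV. cnj (v $ i) * H $ i $ j * w $ j)"

definition hermitian_matrix :: "complex^'n^'n \<Rightarrow> bool" where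
  "hermitian_matrix H \<longleftrightarrow> (\<forall>i j. H $ j $ i = cnj (H $ i $ j))"

text \<open>
  Signature in the sense of Sylvester's law of inertia. Pairwise orthogonal non-isotropic vectors
  are linearly independent, so the family \<open>e\<close>, indexed by \<open>'n\<close>, is a basis; hence the form is
  nondegenerate and \<open>p + q = CARD('n)\<close>.
\<close>

definition has_signature :: "complex^'n^'n \<Rightarrow> nat \<Rightarrow> nat \<Rightarrow> bool" where
  "has_signature H p q \<longleftrightarrow>
     (\<exists>e :: 'n \<Rightarrow> complex^'n.
        (\<forall>i j. i \<noteq> j \<longrightarrow> sesquilinear_form H (e i) (e j) = 0) \<and>
        (\<forall>i. sesquilinear_form H (e i) (e i) \<in> {1, - 1}) \<and>
        card {i. sesquilinear_form H (e i) (e i) = 1} = p \<and>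
        card {i. sesquilinear_form H (e i) (e i) = - 1} = q)"

definition pseudo_unitary :: "complex^'n^'n \<Rightarrow> (complex^'n^'n) set" where
  "pseudo_unitary H =
     {A. \<forall>v w. sesquilinear_form H (A *v v) (A *v w) = sesquilinear_form H v w}"

text \<open>
  The Oseledets subspace of the exponent \<open>c\<close> at the point \<open>x\<close>. The argument \<open>\<tau>\<close> is the inclusion
  of the time group in the reals.
\<close>

definition oseledets_space ::
    "('t::linorder \<Rightarrow> real) \<Rightarrow> ('t \<Rightarrow> 'a \<Rightarrow> complex^'n^'n) \<Rightarrow> 'a \<Rightarrow> real \<Rightarrow> (complex^'n) set" where
  "oseledets_space \<tau> U x c =
     {v. v = 0 \<or>
         (((\<lambda>t. ln (norm (U t x *v v)) / \<tau> t) \<longlongrightarrow> c) at_top \<and>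
          ((\<lambda>t. ln (norm (U t x *v v)) / \<tau> t) \<longlongrightarrow> c) at_bot)}"

text \<open>
  The list of exponents provided by the Oseledets theorem for an ergodic invertible system: at
  almost every point the space is the sum of the Oseledets subspaces, and each exponent is listed
  as many times as the complex dimension of its subspace (\<open>vec.dim\<close> is the dimension over
  the complex numbers). The dimensions add up to the length of the list, so the sum is direct;
  for a nonzero measure the list is therefore unique. The subspaces of numbers \<open>c\<close> that are not
  exponents are zero.
\<close>

definition lyapunov_spectrum ::
    "'a measure \<Rightarrow> ('t::linorder \<Rightarrow> real) \<Rightarrow> ('t \<Rightarrow> 'a \<Rightarrow> complex^'n^'n) \<Rightarrow> real list \<Rightarrow> bool" where
  "lyapunov_spectrum M \<tau> U ls \<longleftrightarrow>
     length ls = CARD('n) \<and> sorted_wrt (\<ge>) ls \<and>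
     (AE x in M.
        (\<forall>c. vec.subspace (oseledets_space \<tau> U x c) \<and>
             vec.dim (oseledets_space \<tau> U x c) = count_list ls c) \<and>
        vec.span (\<Union>c. oseledets_space \<tau> U x c) = UNIV)"

end

theory Submission
  imports Defs "HOL-Library.Multiset"
begin

text \<open>
  Only a single point of the base where the Oseledets decomposition holds is needed. The form is
  constant along \<open>U t v\<close>, \<open>U t w\<close>, while for \<open>v\<close>, \<open>w\<close> in the subspaces of \<open>c\<close>, \<open>d\<close> it is
  bounded by about \<open>exp (t (c + d))\<close>; letting \<open>t\<close> tend to the infinity of the sign opposite to
  \<open>c + d\<close> shows that these subspaces are orthogonal unless \<open>c + d = 0\<close>. Since the form is
  nondegenerate, it must therefore pair the subspaces of \<open>c\<close> and \<open>- c\<close> perfectly, which gives the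
  symmetry. The sum of the subspaces of positive exponents is isotropic, so its dimension is at
  most \<open>min p q\<close>.
\<close>

section \<open>Algebra and size of sesquilinear forms\<close>

lemma sesquilinear_form_add_right:
  "sesquilinear_form H v (w + w') = sesquilinear_form H v w + sesquilinear_form H v w'"
  by (simp add: sesquilinear_form_def algebra_simps sum.distrib)

lemma sesquilinear_form_scale_right:
  "sesquilinear_form H v (a *s w) = a * sesquilinear_form H v w"
  by (simp add: sesquilinear_form_def sum_distrib_left mult_ac)

lemma sesquilinear_form_diff_right:
  "sesquilinear_form H v (w - w') = sesquilinear_form H v w - sesquilinear_form H v w'"
  by (simp add: sesquilinear_form_def algebra_simps sum_subtractf)

lemma sesquilinear_form_zero_right [simp]: "sesquilinear_form H v 0 = 0"
  by (simp add: sesquilinear_form_def)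

lemma sesquilinear_form_sum_right:
  "sesquilinear_form H v (\<Sum>i\<in>I. f i) = (\<Sum>i\<in>I. sesquilinear_form H v (f i))"
  by (induction I rule: infinite_finite_induct) (simp_all add: sesquilinear_form_add_right)

lemma sesquilinear_form_commute:
  assumes "hermitian_matrix H"
  shows "sesquilinear_form H w v = cnj (sesquilinear_form H v w)"
proof -
  have "cnj (sesquilinear_form H v w) = (\<Sum>i\<in>UNIV. \<Sum>j\<in>UNIV. cnj (w $ j) * H $ j $ i * v $ i)"
  proof -
    have "cnj (H $ i $ j) = H $ j $ i" for i j
      using assms unfolding hermitian_matrix_def by metis
    then show ?thesis by (simp add: sesquilinear_form_def mult_ac)
  qed
  also have "\<dots> = sesquilinear_form H w v"
    unfolding sesquilinear_form_def by (rule sum.swap)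
  finally show ?thesis by simp
qed

lemma norm_sesquilinear_form_le:
  "norm (sesquilinear_form H v w) \<le> (\<Sum>i\<in>UNIV. \<Sum>j\<in>UNIV. norm (H $ i $ j)) * (norm v * norm w)"
proof -
  have "norm (sesquilinear_form H v w)
      \<le> (\<Sum>i\<in>UNIV. \<Sum>j\<in>UNIV. norm (cnj (v $ i) * H $ i $ j * w $ j))"
    unfolding sesquilinear_form_def by (intro sum_norm_le order.trans[OF norm_sum] order_refl)
  also have "\<dots> \<le> (\<Sum>i\<in>UNIV. \<Sum>j\<in>UNIV. norm (H $ i $ j) * (norm v * norm w))"
  proof (intro sum_mono)
    fix i j
    have "norm (v $ i) * norm (w $ j) \<le> norm v * norm w"
      by (intro mult_mono Finite_Cartesian_Product.norm_nth_le) auto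
    then have "norm (H $ i $ j) * (norm (v $ i) * norm (w $ j)) \<le> norm (H $ i $ j) * (norm v * norm w)"
      by (rule mult_left_mono) simp
    then show "norm (cnj (v $ i) * H $ i $ j * w $ j) \<le> norm (H $ i $ j) * (norm v * norm w)"
      by (simp add: norm_mult mult_ac)
  qed
  finally show ?thesis by (simp add: sum_distrib_right)
qed

text \<open>Span induction runs in the linear second argument only; Hermitian symmetry swaps the
  arguments, so two passes extend orthogonality from generators to spans.\<close>

lemma sesquilinear_form_span_eq_0:
  assumes "hermitian_matrix H"
    and "\<And>v w. v \<in> A \<Longrightarrow> w \<in> B \<Longrightarrow> sesquilinear_form H v w = 0"
    and "v \<in> vec.span A" "w \<in> vec.span B"
  shows "sesquilinear_form H v w = 0"
proof -
  have right: "sesquilinear_form H a y = 0"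
    if "\<And>b. b \<in> C \<Longrightarrow> sesquilinear_form H a b = 0" "y \<in> vec.span C" for a y C
    using that(2) by (induction rule: vec.span_induct_alt)
      (simp_all add: sesquilinear_form_add_right sesquilinear_form_scale_right that(1))
  have "sesquilinear_form H w a = 0" if "a \<in> A" for a
  proof -
    have "sesquilinear_form H a w = 0"
      using right[of B a w] assms(2)[OF that] assms(4) by blast
    then show ?thesis
      by (simp add: sesquilinear_form_commute[OF assms(1), of w a])
  qed
  then have "sesquilinear_form H w v = 0"
    using right[of A w v] assms(3) by blast
  then show ?thesis
    by (simp add: sesquilinear_form_commute[OF assms(1), of v w])
qed

section \<open>Dimension counts\<close>

text \<open>Each \<open>s\<close> imposes the vanishing of one linear functional, which lowers the
  dimension by at most one.\<close>

lemma dim_le_dim_orthogonal_add_card: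
  fixes V :: "(complex^'n) set"
  assumes "finite S" "vec.subspace V"
  shows "vec.dim V \<le> vec.dim {v\<in>V. \<forall>s\<in>S. sesquilinear_form H s v = 0} + card S"
  using assms
proof (induction S)
  case empty
  then show ?case by simp
next
  case (insert s S)
  define W where "W = {v\<in>V. \<forall>s\<in>S. sesquilinear_form H s v = 0}"
  define W' where "W' = {v\<in>W. sesquilinear_form H s v = 0}"
  have W: "vec.subspace W"
    using \<open>vec.subspace V\<close> unfolding W_def vec.subspace_def
    by (simp add: sesquilinear_form_add_right sesquilinear_form_scale_right)
  have "vec.dim W \<le> vec.dim W' + 1"
  proof (cases "W \<subseteq> W'")
    case True
    then show ?thesis using vec.dim_subset[of W W'] by simp
  next
    case False
    then obtain u where u: "u \<in> W" "sesquilinear_form H s u \<noteq> 0" by (auto simp: W'_def)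
    \<comment> \<open>The multiple \<open>?k\<close> of \<open>u\<close> is the one whose
      subtraction brings \<open>v\<close> into the kernel of the functional of
      \<open>s\<close>.\<close>
    have "W \<subseteq> vec.span (insert u W')"
    proof
      fix v assume v: "v \<in> W"
      let ?k = "sesquilinear_form H s v / sesquilinear_form H s u"
      have "v - ?k *s u \<in> W"
        using v u W by (intro vec.subspace_diff vec.subspace_scale)
      then have "v - ?k *s u \<in> W'"
        using u by (simp add: W'_def sesquilinear_form_diff_right sesquilinear_form_scale_right)
      then have "v - ?k *s u \<in> vec.span W'"
        by (rule vec.span_base)
      then show "v \<in> vec.span (insert u W')"
        by (auto simp: vec.span_insert)
    qed
    then have "vec.dim W \<le> vec.dim (insert u W')" by (rule vec.dim_mono)
    then show ?thesis by (simp add: vec.dim_insert split: if_splits)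
  qed
  moreover have "W' = {v\<in>V. \<forall>s\<in>insert s S. sesquilinear_form H s v = 0}"
    by (auto simp: W'_def W_def)
  ultimately show ?case using insert W_def by simp
qed

lemma dim_Un_le:
  fixes A B :: "(complex^'n) set"
  shows "vec.dim (A \<union> B) \<le> vec.dim A + vec.dim B"
proof -
  obtain a where a: "vec.independent a" "A \<subseteq> vec.span a" "card a = vec.dim A"
    by (meson vec.basis_exists)
  obtain b where b: "vec.independent b" "B \<subseteq> vec.span b" "card b = vec.dim B"
    by (meson vec.basis_exists)
  have "A \<union> B \<subseteq> vec.span (a \<union> b)"
    using a(2) b(2) vec.span_mono[of a "a \<union> b"] vec.span_mono[of b "a \<union> b"] by blast
  then have "vec.dim (A \<union> B) \<le> card (a \<union> b)"
    using a(1) b(1) by (intro vec.dim_le_card) (auto intro: vec.finiteI_independent)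
  also have "\<dots> \<le> card a + card b" by (rule card_Un_le)
  finally show ?thesis using a b by simp
qed

lemma dim_UN_le:
  fixes E :: "'i \<Rightarrow> (complex^'n) set"
  assumes "finite I"
  shows "vec.dim (\<Union>i\<in>I. E i) \<le> (\<Sum>i\<in>I. vec.dim (E i))"
  using assms
proof (induction I)
  case (insert i I)
  then show ?case using dim_Un_le[of "E i" "\<Union>i\<in>I. E i"] by simp
qed simp

section \<open>Orthogonal bases, signature and isotropic subspaces\<close>

text \<open>Pairing a combination of the \<open>e i\<close> with \<open>e j\<close> isolates the
  coefficient \<open>a j\<close>. This gives independence, and the vectors are as many as the
  dimension, hence form a basis.\<close>

lemma orthogonal_basis_expansion:
  fixes e :: "'n \<Rightarrow> complex^'n"
  assumes orth: "\<And>i j. i \<noteq> j \<Longrightarrow> sesquilinear_form H (e i) (e j) = 0"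
    and unit: "\<And>i. sesquilinear_form H (e i) (e i) \<in> {1, - 1}"
  shows "\<exists>a. v = (\<Sum>i\<in>UNIV. a i *s e i) \<and>
    (\<forall>j. sesquilinear_form H (e j) v = a j * sesquilinear_form H (e j) (e j))"
proof -
  have nonzero: "sesquilinear_form H (e i) (e i) \<noteq> 0" for i
    using unit[of i] by auto
  \<comment> \<open>If \<open>e i = e j\<close> with \<open>i\<close> and \<open>j\<close> distinct,
    orthogonality would make \<open>e i\<close> isotropic.\<close>
  have inj: "inj e"
    using orth nonzero by (intro injI) metis
  have coeff: "sesquilinear_form H (e j) (\<Sum>i\<in>UNIV. a i *s e i)
      = a j * sesquilinear_form H (e j) (e j)" for a j
  proof -
    have "sesquilinear_form H (e j) (\<Sum>i\<in>UNIV. a i *s e i)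
        = (\<Sum>i\<in>UNIV. a i * sesquilinear_form H (e j) (e i))"
      by (simp add: sesquilinear_form_sum_right sesquilinear_form_scale_right)
    also have "\<dots> = (\<Sum>i\<in>UNIV. if i = j then a j * sesquilinear_form H (e j) (e j) else 0)"
      using orth by (intro sum.cong) auto
    finally show ?thesis by simp
  qed
  have "vec.independent (range e)"
  proof (rule vec.independent_if_scalars_zero)
    fix f x assume "(\<Sum>x\<in>range e. f x *s x) = 0" "x \<in> range e"
    then obtain j where j: "x = e j" and "(\<Sum>i\<in>UNIV. f (e i) *s e i) = 0"
      using inj by (auto simp: sum.reindex)
    then show "f x = 0" using coeff[of j "\<lambda>i. f (e i)"] nonzero[of j] by simp
  qed simp
  then have "UNIV \<subseteq> vec.span (range e)"
    using inj by (intro vec.card_ge_dim_independent) (simp_all add: card_image vec_dim_card del: vec.dim_UNIV)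
  then have "v \<in> range (\<lambda>u. \<Sum>x\<in>range e. u x *s x)"
    by (subst vec.span_finite[symmetric]) auto
  then obtain u where "v = (\<Sum>x\<in>range e. u x *s x)" by auto
  then have "v = (\<Sum>i\<in>UNIV. u (e i) *s e i)" using inj by (simp add: sum.reindex)
  then show ?thesis using coeff[of _ "\<lambda>i. u (e i)"] by (intro exI[of _ "\<lambda>i. u (e i)"]) auto
qed

text \<open>The coefficients of \<open>v\<close> in the orthogonal basis are, up to sign, its
  pairings with the basis vectors.\<close>

lemma has_signature_imp_nondegenerate:
  fixes H :: "complex^'n^'n"
  assumes "has_signature H p q" and "\<And>w. sesquilinear_form H w v = 0"
  shows "v = 0"
proof -
  obtain e :: "'n \<Rightarrow> complex^'n" where e: "\<And>i j. i \<noteq> j \<Longrightarrow> sesquilinear_form H (e i) (e j) = 0"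
    "\<And>i. sesquilinear_form H (e i) (e i) \<in> {1, - 1}"
    using assms(1) by (auto simp: has_signature_def)
  obtain a where a: "v = (\<Sum>i\<in>UNIV. a i *s e i)"
    "\<And>j. sesquilinear_form H (e j) v = a j * sesquilinear_form H (e j) (e j)"
    using orthogonal_basis_expansion[of H e v] e by blast
  have "a j = 0" for j
    using a(2)[of j] assms(2)[of "e j"] e(2)[of j] by auto
  then show ?thesis using a(1) by simp
qed

lemma has_signature_imp_sum:
  fixes H :: "complex^'n^'n"
  assumes "has_signature H p q"
  shows "p + q = CARD('n)"
proof -
  obtain e :: "'n \<Rightarrow> complex^'n" where e: "\<And>i. sesquilinear_form H (e i) (e i) \<in> {1, - 1}"
    "card {i. sesquilinear_form H (e i) (e i) = 1} = p"
    "card {i. sesquilinear_form H (e i) (e i) = - 1} = q"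
    using assms by (auto simp: has_signature_def)
  have "UNIV = {i. sesquilinear_form H (e i) (e i) = 1} \<union> {i. sesquilinear_form H (e i) (e i) = - 1}"
    using e(1) by auto
  then have "CARD('n) = card \<dots>" by simp
  also have "\<dots> = p + q"
    using e by (subst card_Un_disjoint) auto
  finally show ?thesis by simp
qed

text \<open>
  A vector of the isotropic subspace that is orthogonal to all basis vectors of one sign lies in
  the span of those of the other sign, where the form is definite.
\<close>

lemma dim_isotropic_le_card:
  fixes V :: "(complex^'n) set"
  assumes "hermitian_matrix H"
    and orth: "\<And>i j. i \<noteq> j \<Longrightarrow> sesquilinear_form H (e i) (e j) = 0"
    and unit: "\<And>i. sesquilinear_form H (e i) (e i) \<in> {1, - 1}"
    and V: "vec.subspace V" "\<And>v. v \<in> V \<Longrightarrow> sesquilinear_form H v v = 0"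
    and s: "s \<in> {1, - 1}"
  shows "vec.dim V \<le> card {i :: 'n. sesquilinear_form H (e i) (e i) = s}"
proof -
  define S where "S = {i. sesquilinear_form H (e i) (e i) = s}"
  have "v = 0" if v: "v \<in> V" "\<And>i. i \<in> S \<Longrightarrow> sesquilinear_form H (e i) v = 0" for v
  proof -
    obtain a where a: "v = (\<Sum>i\<in>UNIV. a i *s e i)"
      "\<And>j. sesquilinear_form H (e j) v = a j * sesquilinear_form H (e j) (e j)"
      using orthogonal_basis_expansion[of H e v] orth unit by blast
    have a0: "a i = 0" if "i \<in> S" for i
      using a(2)[of i] v(2)[OF that] unit[of i] by auto
    \<comment> \<open>On \<open>S\<close> both sides vanish; off \<open>S\<close> the vector
      \<open>e i\<close> has square \<open>- s\<close>. Hence the form at \<open>v\<close> is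
      \<open>- s\<close> times the sum of the squared moduli of the coefficients, and isotropy makes
      them all zero.\<close>
    have "sesquilinear_form H v (e i) = - s * cnj (a i)" for i
    proof (cases "i \<in> S")
      case True
      then show ?thesis
        using a0 v(2) sesquilinear_form_commute[OF assms(1), of v "e i"] by simp
    next
      case False
      then have "sesquilinear_form H (e i) (e i) = - s"
        using unit[of i] s by (auto simp: S_def)
      then show ?thesis
        using a(2)[of i] sesquilinear_form_commute[OF assms(1), of v "e i"] s by auto
    qed
    then have "sesquilinear_form H v v = (\<Sum>i\<in>UNIV. a i * (- s * cnj (a i)))"
      by (subst (2) a(1)) (simp add: sesquilinear_form_sum_right sesquilinear_form_scale_right)
    also have "\<dots> = - s * of_real (\<Sum>i\<in>UNIV. (norm (a i))\<^sup>2)"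
      by (simp add: sum_distrib_left complex_norm_square mult_ac del: of_real_power)
    finally have "of_real (\<Sum>i\<in>UNIV. (norm (a i))\<^sup>2) = (0 :: complex)"
      using V(2)[OF v(1)] s by auto
    then have "(\<Sum>i\<in>UNIV. (norm (a i))\<^sup>2) = 0"
      by (simp only: of_real_eq_0_iff)
    then have "\<forall>i\<in>UNIV. (norm (a i))\<^sup>2 = 0"
      by (subst (asm) sum_nonneg_eq_0_iff) auto
    then show ?thesis using a(1) by simp
  qed
  then have "{v\<in>V. \<forall>x\<in>e ` S. sesquilinear_form H x v = 0} \<subseteq> {0}" by auto
  then have "vec.dim {v\<in>V. \<forall>x\<in>e ` S. sesquilinear_form H x v = 0} = 0" by simp
  then have "vec.dim V \<le> card (e ` S)"
    using dim_le_dim_orthogonal_add_card[OF finite_imageI[OF finite] V(1), of e S H] by linarith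
  also have "\<dots> \<le> card S" by (rule card_image_le) simp
  finally show ?thesis by (simp add: S_def)
qed

lemma has_signature_imp_dim_isotropic_le:
  fixes H :: "complex^'n^'n"
  assumes "hermitian_matrix H" "has_signature H p q"
    and "vec.subspace V" "\<And>v. v \<in> V \<Longrightarrow> sesquilinear_form H v v = 0"
  shows "vec.dim V \<le> min p q"
proof -
  obtain e :: "'n \<Rightarrow> complex^'n" where "\<And>i j. i \<noteq> j \<Longrightarrow> sesquilinear_form H (e i) (e j) = 0"
    "\<And>i. sesquilinear_form H (e i) (e i) \<in> {1, - 1}"
    "card {i. sesquilinear_form H (e i) (e i) = 1} = p"
    "card {i. sesquilinear_form H (e i) (e i) = - 1} = q"
    using assms(2) by (auto simp: has_signature_def)
  then show ?thesis
    using dim_isotropic_le_card[OF assms(1) _ _ assms(3,4), of e 1]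
      dim_isotropic_le_card[OF assms(1) _ _ assms(3,4), of e "- 1"] by auto
qed

section \<open>Spaces graded by real numbers, with opposite degrees paired\<close>

text \<open>Serves to read the number of nonpositive exponents as a sum of dimensions of their
  spaces.\<close>

lemma length_filter_eq_sum_count_list:
  "length (filter P xs) = (\<Sum>x\<in>{x\<in>set xs. P x}. count_list xs x)"
proof -
  have "count_list (filter P xs) x = count_list xs x" if "P x" for x
    using that by (induction xs) auto
  then show ?thesis
    using sum_count_set[of "filter P xs" "{x\<in>set xs. P x}"] by simp
qed

text \<open>The linear algebra at one base point, where \<open>E c\<close> will be the Oseledets
  subspace of \<open>c\<close>.\<close>

lemma graded_form_symmetric:
  fixes H :: "complex^'n^'n" and ls :: "real list"
  assumes H: "hermitian_matrix H" "has_signature H p q"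
    and sub: "\<And>c. vec.subspace (E c)"
    and dim: "\<And>c. vec.dim (E c) = count_list ls c"
    and span: "vec.span (\<Union>c. E c) = UNIV"
    and len: "length ls = CARD('n)"
    and orth: "\<And>c d v w. v \<in> E c \<Longrightarrow> w \<in> E d \<Longrightarrow> c + d \<noteq> 0 \<Longrightarrow> sesquilinear_form H v w = 0"
  shows "count_list ls (- c) = count_list ls c"
    and "length (filter (\<lambda>c. 0 < c) ls) \<le> min p q"
proof -
  \<comment> \<open>A vector of \<open>E c\<close> orthogonal to a basis of \<open>E (- c)\<close>
    is orthogonal to every \<open>E d\<close>, hence to the whole space, and is zero by
    nondegeneracy. The reverse inequality is the same one at \<open>- c\<close>.\<close>
  have le: "vec.dim (E c) \<le> vec.dim (E (- c))" for c
  proof -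
    obtain B where B: "B \<subseteq> E (- c)" "vec.independent B" "E (- c) \<subseteq> vec.span B"
      "card B = vec.dim (E (- c))" by (meson vec.basis_exists)
    have "v = 0" if v: "v \<in> E c" "\<forall>b\<in>B. sesquilinear_form H b v = 0" for v
    proof (rule has_signature_imp_nondegenerate[OF H(2)])
      fix w
      have "sesquilinear_form H u v = 0" if u: "u \<in> (\<Union>c. E c)" for u
      proof -
        obtain d where d: "u \<in> E d" using u by auto
        show ?thesis
        proof (cases "d = - c")
          case True
          then have "u \<in> vec.span B" using B(3) d by auto
          then show ?thesis
            using sesquilinear_form_span_eq_0[OF H(1), of B "{v}" u v] v(2)
            by (auto intro: vec.span_base)
        next
          case False
          then have "d + c \<noteq> 0" by linarith
          then show ?thesis by (rule orth[OF d v(1)])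
        qed
      qed
      then show "sesquilinear_form H w v = 0"
        using sesquilinear_form_span_eq_0[OF H(1), of "\<Union>c. E c" "{v}" w v] span
        by (auto intro: vec.span_base)
    qed
    then have "{v\<in>E c. \<forall>b\<in>B. sesquilinear_form H b v = 0} \<subseteq> {0}" by auto
    then have "vec.dim {v\<in>E c. \<forall>b\<in>B. sesquilinear_form H b v = 0} = 0" by simp
    then show ?thesis
      using dim_le_dim_orthogonal_add_card[OF vec.finiteI_independent[OF B(2)] sub[of c], of H] B(4)
      by linarith
  qed
  show "count_list ls (- c) = count_list ls c"
    using le[of c] le[of "- c"] dim by simp
  define P where "P = vec.span (\<Union>c\<in>{0<..}. E c)"
  \<comment> \<open>Two positive exponents, equal or not, never add up to 0, so the generators of
    \<open>P\<close> are mutually orthogonal and each is isotropic.\<close>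
  have "sesquilinear_form H v v = 0" if "v \<in> P" for v
    using that unfolding P_def
    by (rule sesquilinear_form_span_eq_0[OF H(1), rotated]) (use that orth in \<open>force simp: P_def\<close>)+
  then have "vec.dim P \<le> min p q"
    by (intro has_signature_imp_dim_isotropic_le[OF H]) (simp_all add: P_def)
  \<comment> \<open>The dimension of \<open>P\<close> is bounded below by subadditivity:
    \<open>P\<close> and the remaining spaces \<open>N\<close> together span everything, and
    \<open>N\<close> contributes at most the number of nonpositive entries.\<close>
  moreover have "length ls \<le> vec.dim P + length (filter (\<lambda>c. \<not> 0 < c) ls)"
  proof -
    define N where "N = (\<Union>c\<in>{c\<in>set ls. \<not> 0 < c}. E c)"
    \<comment> \<open>Reduces the union over all real numbers to one over finitely many nonpositive
      exponents.\<close>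
    have zero: "E c \<subseteq> {0}" if "c \<notin> set ls" for c
      using that dim[of c] by (metis count_notin vec.dim_eq_0)
    have "E c \<subseteq> vec.span (P \<union> N)" for c
    proof (cases "0 < c \<or> c \<in> set ls")
      case True
      then have "E c \<subseteq> P \<union> N"
        by (auto simp: P_def N_def intro: vec.span_base)
      then show ?thesis using vec.span_superset by blast
    next
      case False
      then show ?thesis using zero[of c] vec.span_zero by blast
    qed
    then have "vec.dim (\<Union>c. E c) \<le> vec.dim (P \<union> N)"
      by (intro vec.dim_mono) auto
    moreover have "vec.dim (\<Union>c. E c) = CARD('n)"
      by (metis span vec.dim_span vec_dim_card)
    moreover have "vec.dim N \<le> length (filter (\<lambda>c. \<not> 0 < c) ls)"
      using dim_UN_le[of "{c\<in>set ls. \<not> 0 < c}" E]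
      by (simp only: N_def length_filter_eq_sum_count_list dim finite_set finite_Collect_conjI)
        simp
    ultimately show ?thesis using dim_Un_le[of P N] len by linarith
  qed
  ultimately show "length (filter (\<lambda>c. 0 < c) ls) \<le> min p q"
    using sum_length_filter_compl[of "\<lambda>c. 0 < c" ls] by linarith
qed

section \<open>Shape of a sorted symmetric list\<close>

text \<open>Negation reverses such a list, so the entries at mirrored positions are opposite. The
  bound on the positive entries makes everything after the first block nonpositive, and mirroring
  makes everything before the last block nonnegative; the overlap is the block of zeros.\<close>

lemma sorted_symmetric_list:
  fixes ls :: "real list"
  assumes sorted: "sorted_wrt (\<ge>) ls"
    and sym: "\<And>c. count_list ls (- c) = count_list ls c"
    and len: "length ls = p + q"
    and pos: "length (filter (\<lambda>c. 0 < c) ls) \<le> min p q"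
  obtains ms where "length ms = min p q" "sorted_wrt (\<ge>) ms" "\<forall>l\<in>set ms. l \<ge> 0"
    "ls = ms @ replicate (nat \<bar>int p - int q\<bar>) 0 @ map uminus (rev ms)"
proof -
  define m where "m = min p q"
  define k where "k = nat \<bar>int p - int q\<bar>"
  have n: "length ls = m + k + m" using len by (auto simp: m_def k_def min_def)
  \<comment> \<open>Both lists are ascending and have the same multiset of entries.\<close>
  have "map uminus ls = rev ls"
  proof -
    have "count_list (map uminus ls) c = count_list (rev ls) c" for c
      using count_list_map_conv[of uminus ls "- c"] sym[of c] by (simp add: inj_def)
    then have "mset (map uminus ls) = mset (rev ls)"
      by (intro multiset_eqI) (simp only: count_mset)
    moreover have "sorted (rev ls)" using sorted by (simp add: sorted_wrt_rev)
    moreover have "sorted (map uminus ls)" using sorted by (simp add: sorted_wrt_map)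
    ultimately show ?thesis by (metis properties_for_sort)
  qed
  then have refl: "ls ! i = - ls ! (length ls - Suc i)" if "i < length ls" for i
    using that nth_map[of i ls uminus] rev_nth[of i ls] by simp
  have mono: "ls ! j \<le> ls ! i" if "i \<le> j" "j < length ls" for i j
    using sorted that by (cases "i = j") (auto simp: sorted_wrt_iff_nth_less)
  \<comment> \<open>A positive entry at \<open>i\<close> would force the \<open>Suc i\<close>
    entries up to it to be positive, more than \<open>m\<close>.\<close>
  have nonpos: "ls ! i \<le> 0" if i: "m \<le> i" "i < length ls" for i
  proof (rule ccontr)
    assume "\<not> ls ! i \<le> 0"
    then have "{..i} \<subseteq> {j. j < length ls \<and> 0 < ls ! j}"
      using mono i by force
    then have "card {..i} \<le> card {j. j < length ls \<and> 0 < ls ! j}"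
      by (intro card_mono) auto
    then have "Suc i \<le> m" using pos unfolding length_filter_conv_card m_def by simp
    then show False using i by simp
  qed
  have nonneg: "0 \<le> ls ! i" if "i < m + k" for i
    using refl[of i] nonpos[of "length ls - Suc i"] that n by simp
  define ms where "ms = take m ls"
  have "ls = ms @ replicate k 0 @ map uminus (rev ms)"
  proof (rule nth_equalityI)
    show "length ls = length (ms @ replicate k 0 @ map uminus (rev ms))"
      by (simp add: ms_def n)
    fix i assume i: "i < length ls"
    consider "i < m" | "m \<le> i" "i < m + k" | "m + k \<le> i" by linarith
    then show "ls ! i = (ms @ replicate k 0 @ map uminus (rev ms)) ! i"
    proof cases
      case 1
      then show ?thesis by (simp add: ms_def n nth_append)
    next
      case 2
      then show ?thesis
        using nonpos[of i] nonneg[of i] i by (simp add: ms_def n nth_append)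
    next
      case 3
      \<comment> \<open>The mirror image of \<open>i\<close> is the position in \<open>ms\<close>
        that \<open>rev ms\<close> reads at offset \<open>i - m - k\<close> of the last
        block.\<close>
      have "length ls - Suc i = m - Suc (i - m - k)" using 3 i n by simp
      then show ?thesis
        using 3 i n refl[OF i] by (simp add: ms_def nth_append rev_nth)
    qed
  qed
  moreover have "length ms = m" by (simp add: ms_def n)
  moreover have "sorted_wrt (\<ge>) ms" using sorted by (simp add: ms_def )
  moreover have "\<forall>l\<in>set ms. l \<ge> 0"
    using nonneg by (auto simp: ms_def in_set_conv_nth)
  ultimately show thesis using that by (simp add: m_def k_def)
qed

section \<open>Growth rates and orthogonality of Oseledets subspaces\<close>

text \<open>The logarithm of the product is about \<open>(c + d) * \<tau> t\<close>, which tends to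
  minus infinity in both sign combinations.\<close>

lemma norm_mult_tendsto_0:
  assumes a: "((\<lambda>t. ln (norm (a t)) / \<tau> t) \<longlongrightarrow> c) F" and b: "((\<lambda>t. ln (norm (b t)) / \<tau> t) \<longlongrightarrow> d) F"
    and \<tau>: "filterlim \<tau> at_top F \<and> c + d < 0 \<or> filterlim \<tau> at_bot F \<and> c + d > 0"
  shows "((\<lambda>t. norm (a t) * norm (b t)) \<longlongrightarrow> 0) F"
proof -
  let ?s = "\<lambda>t. ln (norm (a t)) / \<tau> t + ln (norm (b t)) / \<tau> t"
  have "filterlim (\<lambda>t. ?s t * \<tau> t) at_bot F"
    using \<tau> filterlim_tendsto_neg_mult_at_bot[OF tendsto_add[OF a b]]
      filterlim_tendsto_pos_mult_at_bot[OF tendsto_add[OF a b]] by blast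
  then have lim: "((\<lambda>t. exp (?s t * \<tau> t)) \<longlongrightarrow> 0) F"
    by (rule filterlim_compose[OF exp_at_bot])
  \<comment> \<open>At \<open>r = 0\<close> the logarithm has only a default value; the bound holds
    there because \<open>exp\<close> is positive, whereas equality fails. An upper bound is enough
    for the squeeze.\<close>
  have le: "r \<le> exp (ln r)" for r :: real
    by (cases "0 < r") (auto intro: order.trans[of _ 0])
  \<comment> \<open>Allows the factor \<open>\<tau> t\<close> to cancel the denominators.\<close>
  have "eventually (\<lambda>t. \<tau> t \<noteq> 0) F"
    using \<tau> by (auto simp: filterlim_at_top_dense filterlim_at_bot_dense elim!: allE[of _ 0] eventually_mono)
  then have "eventually (\<lambda>t. norm (a t) * norm (b t) \<le> exp (?s t * \<tau> t)) F"
  proof eventually_elim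
    case (elim t)
    then have "exp (?s t * \<tau> t) = exp (ln (norm (a t))) * exp (ln (norm (b t)))"
      by (simp add: distrib_right exp_add)
    then show ?case using mult_mono[OF le le] by simp
  qed
  then show ?thesis
    by (intro tendsto_sandwich[OF _ _ tendsto_const lim]) auto
qed

text \<open>The limits in both time directions are used: for \<open>c + d < 0\<close> the product of
  the norms decays at \<open>at_top\<close>, for \<open>c + d > 0\<close> at \<open>at_bot\<close>.
  The sorts \<open>no_top\<close> and \<open>no_bot\<close> make these filters proper.\<close>

lemma oseledets_space_orthogonal:
  fixes \<tau> :: "'t::{linorder,no_top,no_bot} \<Rightarrow> real"
  assumes \<tau>: "filterlim \<tau> at_top at_top" "filterlim \<tau> at_bot at_bot"
    and U: "\<And>t. U t x \<in> pseudo_unitary H"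
    and v: "v \<in> oseledets_space \<tau> U x c" and w: "w \<in> oseledets_space \<tau> U x d"
    and cd: "c + d \<noteq> 0"
  shows "sesquilinear_form H v w = 0"
proof (cases "v = 0 \<or> w = 0")
  case True
  then show ?thesis by (auto simp: sesquilinear_form_def)
next
  case False
  then have lim:
    "((\<lambda>t. ln (norm (U t x *v v)) / \<tau> t) \<longlongrightarrow> c) at_top"
    "((\<lambda>t. ln (norm (U t x *v v)) / \<tau> t) \<longlongrightarrow> c) at_bot"
    "((\<lambda>t. ln (norm (U t x *v w)) / \<tau> t) \<longlongrightarrow> d) at_top"
    "((\<lambda>t. ln (norm (U t x *v w)) / \<tau> t) \<longlongrightarrow> d) at_bot"
    using v w by (auto simp: oseledets_space_def)
  have *: "sesquilinear_form H v w = 0"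
    if F: "F \<noteq> bot" and lim: "((\<lambda>t. norm (U t x *v v) * norm (U t x *v w)) \<longlongrightarrow> 0) F"
    for F
  proof -
    let ?K = "\<Sum>i\<in>UNIV. \<Sum>j\<in>UNIV. norm (H $ i $ j)"
    have "norm (sesquilinear_form H v w) \<le> ?K * (norm (U t x *v v) * norm (U t x *v w))" for t
      using norm_sesquilinear_form_le[of H "U t x *v v" "U t x *v w"] U[of t]
      by (simp add: pseudo_unitary_def)
    then have "norm (sesquilinear_form H v w) \<le> ?K * 0"
      by (intro tendsto_le[OF F tendsto_mult[OF tendsto_const lim] tendsto_const] always_eventually) auto
    then show ?thesis by simp
  qed
  show ?thesis
  proof (cases "c + d < 0")
    case True
    then show ?thesis
      using *[OF _ norm_mult_tendsto_0[OF lim(1,3)]] \<tau> by simp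
  next
    case False
    then show ?thesis
      using *[OF _ norm_mult_tendsto_0[OF lim(2,4)]] \<tau> cd by simp
  qed
qed

section \<open>From the Oseledets decomposition to the spectrum\<close>

lemma lyapunov_spectrum_symmetric:
  fixes \<tau> :: "'t::{linorder,no_top,no_bot} \<Rightarrow> real" and H :: "complex^'n^'n"
  assumes M: "emeasure M (space M) \<noteq> 0"
    and H: "hermitian_matrix H" "has_signature H p q"
    and \<tau>: "filterlim \<tau> at_top at_top" "filterlim \<tau> at_bot at_bot"
    and U: "\<And>t x. x \<in> space M \<Longrightarrow> U t x \<in> pseudo_unitary H"
    and spectrum: "lyapunov_spectrum M \<tau> U ls"
  shows "\<forall>c. count_list ls (- c) = count_list ls c"
    and "length (filter (\<lambda>c. 0 < c) ls) \<le> min p q"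
proof -
  have len: "length ls = CARD('n)" using spectrum by (simp add: lyapunov_spectrum_def)
  \<comment> \<open>As the measure is nonzero, the almost-everywhere filter is proper, and what
    holds almost everywhere holds at some point.\<close>
  have "\<exists>x\<in>space M. (\<forall>c. vec.subspace (oseledets_space \<tau> U x c) \<and>
      vec.dim (oseledets_space \<tau> U x c) = count_list ls c) \<and>
      vec.span (\<Union>c. oseledets_space \<tau> U x c) = UNIV" (is "\<exists>x\<in>space M. ?P x")
  proof -
    have "AE x in M. ?P x" using spectrum unfolding lyapunov_spectrum_def by blast
    then have "AE x in M. x \<in> space M \<and> ?P x" using AE_space[of M] by eventually_elim blast
    then show ?thesis
      using eventually_happens'[of "ae_filter M"] M unfolding ae_filter_eq_bot_iff by blast
  qed
  then obtain x where x: "x \<in> space M" "?P x" by blast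
  note sym = graded_form_symmetric[OF H, of "oseledets_space \<tau> U x" ls]
  have orth: "sesquilinear_form H v w = 0"
    if "v \<in> oseledets_space \<tau> U x c" "w \<in> oseledets_space \<tau> U x d" "c + d \<noteq> 0" for c d v w
    using oseledets_space_orthogonal[OF \<tau> U[OF x(1)] that] .
  show "\<forall>c. count_list ls (- c) = count_list ls c"
    using sym(1) x(2) len orth by blast
  show "length (filter (\<lambda>c. 0 < c) ls) \<le> min p q"
    using sym(2) x(2) len orth by blast
qed

lemma filterlim_real_of_int_at_bot: "filterlim real_of_int at_bot at_bot"
  unfolding filterlim_at_bot eventually_at_bot_linorder by (meson le_floor_iff)

theorem theorem4:
  fixes M :: "'a measure" and H :: "complex^'n^'n" and p q :: nat and ls :: "real list"
  assumes "finite_measure M" and "emeasure M (space M) \<noteq> 0"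
    and "hermitian_matrix H" and "has_signature H p q"
    and "(\<exists>(T :: int \<Rightarrow> 'a \<Rightarrow> 'a) (U :: int \<Rightarrow> 'a \<Rightarrow> complex^'n^'n).
            ergodic_action M T \<and> matrix_cocycle M T U \<and>
            (\<forall>t. \<forall>x\<in>space M. U t x \<in> pseudo_unitary H) \<and>
            log_integrable_discrete M U \<and> lyapunov_spectrum M real_of_int U ls) \<or>
         (\<exists>(T :: real \<Rightarrow> 'a \<Rightarrow> 'a) (U :: real \<Rightarrow> 'a \<Rightarrow> complex^'n^'n).
            ergodic_action M T \<and> matrix_cocycle M T U \<and>
            (\<forall>t. \<forall>x\<in>space M. U t x \<in> pseudo_unitary H) \<and>
            log_integrable_flow M U \<and> lyapunov_spectrum M (\<lambda>t. t) U ls)"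
  shows "(\<forall>c. count_list ls (- c) = count_list ls c) \<and>
         count_list ls 0 \<ge> nat \<bar>int p - int q\<bar> \<and>
         (\<exists>ms. length ms = min p q \<and> sorted_wrt (\<ge>) ms \<and> (\<forall>l\<in>set ms. l \<ge> 0) \<and>
               ls = ms @ replicate (nat \<bar>int p - int q\<bar>) 0 @ map uminus (rev ms)) \<and>
         (min p q = 0 \<longrightarrow> (\<forall>l\<in>set ls. l = 0))"
proof -
  have spec: "length ls = CARD('n)" "sorted_wrt (\<ge>) ls"
    using assms(5) unfolding lyapunov_spectrum_def by blast+
  \<comment> \<open>Both kinds of time are instances of one lemma, with \<open>\<tau>\<close> the
    embedding of the integers or the identity of the reals.\<close>
  from assms(5) have "(\<forall>c. count_list ls (- c) = count_list ls c) \<and>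
      length (filter (\<lambda>c. 0 < c) ls) \<le> min p q"
  proof (elim disjE exE conjE)
    fix U :: "int \<Rightarrow> 'a \<Rightarrow> complex^'n^'n"
    assume "\<forall>t. \<forall>x\<in>space M. U t x \<in> pseudo_unitary H" "lyapunov_spectrum M real_of_int U ls"
    then show ?thesis
      using lyapunov_spectrum_symmetric[OF assms(2-4) filterlim_real_of_int_at_top
          filterlim_real_of_int_at_bot, of U ls] by blast
  next
    fix U :: "real \<Rightarrow> 'a \<Rightarrow> complex^'n^'n"
    assume "\<forall>t. \<forall>x\<in>space M. U t x \<in> pseudo_unitary H" "lyapunov_spectrum M (\<lambda>t. t) U ls"
    then show ?thesis
      using lyapunov_spectrum_symmetric[OF assms(2-4) filterlim_ident filterlim_ident, of U ls]
      by blast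
  qed
  then have sym: "\<forall>c. count_list ls (- c) = count_list ls c"
    and pos: "length (filter (\<lambda>c. 0 < c) ls) \<le> min p q"
    by blast+
  have "length ls = p + q"
    using spec(1) has_signature_imp_sum[OF assms(4)] by simp
  then obtain ms where ms: "length ms = min p q" "sorted_wrt (\<ge>) ms" "\<forall>l\<in>set ms. l \<ge> 0"
    and ls: "ls = ms @ replicate (nat \<bar>int p - int q\<bar>) 0 @ map uminus (rev ms)"
    using sorted_symmetric_list[OF spec(2) _ _ pos] sym by blast
  have "count_list (replicate k 0) (0::real) = k" for k
    by (induction k) auto
  then have "count_list ls 0 \<ge> nat \<bar>int p - int q\<bar>"
    by (subst ls) simp
  \<comment> \<open>Here \<open>ms\<close> is empty, and only the middle zeros remain.\<close>
  moreover have "min p q = 0 \<longrightarrow> (\<forall>l\<in>set ls. l = 0)"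
    using ms(1) by (subst ls) auto
  ultimately show ?thesis using sym ms ls by blast
qed

end
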